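(* For each integer $r \geq 3$ there is a constant $c_r$ such that for all positive integers $n, k$, $$h(n, k, K_r) \le c_r \frac{n^2}{k^{(r-1)/(r-2)}}.$$
   Context: All graphs are finite, undirected and simple. A graph is $H$-free if it does not contain $H$ as a (not necessarily induced) subgraph. For a graph $G$ and a positive integer $k$, $h(G,k)$ is the minimum number of edges that can be deleted from $G$ so that the remaining graph is $k$-colorable. For a graph $H$ and positive integers $n,k$, $h(n,k,H)$ is the maximum of $h(G,k)$ over all $H$-free graphs $G$ on $n$ vertices. $K_r$ is the complete graph on $r$ vertices. *)

theory Defs
  imports Complex_Main "HOL-Library.Ramsey"
begin

text \<open>
  A graph is a vertex set together with a set of edges, each edge being a two-element set of
  vertices; \<^term>\<open>[V]\<^bsup>2\<^esup>\<close> (\<^const>\<open>nsets\<close>) is the set of all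
  two-element subsets of \<^term>\<open>V\<close>.
\<close>

record 'a graph =
  verts :: "'a set"
  edges :: "'a set set"

definition finite_simple_graph :: "'a graph \<Rightarrow> bool" where
  "finite_simple_graph G \<longleftrightarrow> finite (verts G) \<and> edges G \<subseteq> [verts G]\<^bsup>2\<^esup>"

text \<open>The subgraph isomorphic to \<^term>\<open>H\<close> need not be induced.\<close>

definition contains_subgraph :: "'a graph \<Rightarrow> 'b graph \<Rightarrow> bool" where
  "contains_subgraph G H \<longleftrightarrow>
     (\<exists>f. inj_on f (verts H) \<and> f ` verts H \<subseteq> verts G \<and> (\<forall>e\<in>edges H. f ` e \<in> edges G))"

definition subgraph_free :: "'b graph \<Rightarrow> 'a graph \<Rightarrow> bool" where
  "subgraph_free H G \<longleftrightarrow> \<not> contains_subgraph G H"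

definition complete_graph :: "nat \<Rightarrow> nat graph" where
  "complete_graph r = \<lparr>verts = {..<r}, edges = [{..<r}]\<^bsup>2\<^esup>\<rparr>"

definition colorable :: "nat \<Rightarrow> 'a graph \<Rightarrow> bool" where
  "colorable k G \<longleftrightarrow>
     (\<exists>c. c ` verts G \<subseteq> {..<k} \<and> (\<forall>u v. {u, v} \<in> edges G \<longrightarrow> c u \<noteq> c v))"

definition delete_edges :: "'a graph \<Rightarrow> 'a set set \<Rightarrow> 'a graph" where
  "delete_edges G F = \<lparr>verts = verts G, edges = edges G - F\<rparr>"

definition h_graph :: "'a graph \<Rightarrow> nat \<Rightarrow> nat" where
  "h_graph G k = Min {card F | F. F \<subseteq> edges G \<and> colorable k (delete_edges G F)}"

text \<open>
  The maximum ranges over graphs whose vertices are natural numbers; up to isomorphism these are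
  all finite graphs, and lemma \<open>h_graph_le_h_max\<close> below shows that the value bounds
  \<^const>\<open>h_graph\<close> for graphs over an arbitrary vertex type.
\<close>

definition h_max :: "nat \<Rightarrow> nat \<Rightarrow> 'b graph \<Rightarrow> nat" where
  "h_max n k H =
     Max {h_graph G k | G :: nat graph.
       finite_simple_graph G \<and> card (verts G) = n \<and> subgraph_free H G}"

subsection \<open>The extremal values are well defined\<close>

lemma finite_edges: "finite_simple_graph G \<Longrightarrow> finite (edges G)"
  unfolding finite_simple_graph_def by (meson finite_imp_finite_nsets finite_subset)

lemma finite_deletion_sizes:
  "finite_simple_graph G \<Longrightarrow> finite {card F | F. F \<subseteq> edges G \<and> colorable k (delete_edges G F)}"
  by (rule finite_subset[of _ "card ` Pow (edges G)"]) (auto simp: finite_edges)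

lemma colorable_delete_all: "k > 0 \<Longrightarrow> colorable k (delete_edges G (edges G))"
  unfolding colorable_def delete_edges_def by (intro exI[of _ "\<lambda>_. 0"]) auto

lemma deletion_sizes_nonempty:
  "k > 0 \<Longrightarrow> {card F | F. F \<subseteq> edges G \<and> colorable k (delete_edges G F)} \<noteq> {}"
  using colorable_delete_all by blast

lemma h_graph_le_card_edges:
  assumes "finite_simple_graph G" "k > 0"
  shows "h_graph G k \<le> card (edges G)"
  unfolding h_graph_def
  by (rule Min_le[OF finite_deletion_sizes[OF assms(1)]])
    (use colorable_delete_all[OF assms(2)] in blast)

lemma finite_h_values:
  assumes "k > 0"
  shows "finite {h_graph G k | G :: nat graph.
    finite_simple_graph G \<and> card (verts G) = n \<and> subgraph_free H G}"
proof (rule finite_subset)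
  show "{h_graph G k | G :: nat graph.
    finite_simple_graph G \<and> card (verts G) = n \<and> subgraph_free H G} \<subseteq> {..n choose 2}"
  proof clarsimp
    fix G :: "nat graph"
    assume G: "finite_simple_graph G"
    then have "card (edges G) \<le> card ([verts G]\<^bsup>2\<^esup>)"
      unfolding finite_simple_graph_def by (meson card_mono finite_imp_finite_nsets)
    with h_graph_le_card_edges[OF G assms] show "h_graph G k \<le> card (verts G) choose 2"
      by simp
  qed
qed simp

lemma h_values_nonempty:
  assumes "r \<ge> 2"
  shows "{h_graph G k | G :: nat graph.
    finite_simple_graph G \<and> card (verts G) = n \<and> subgraph_free (complete_graph r) G} \<noteq> {}"
proof -
  let ?G = "\<lparr>verts = {..<n}, edges = {}\<rparr> :: nat graph"
  have "{0, 1} \<in> edges (complete_graph r)"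
    using assms by (simp add: complete_graph_def)
  then have "subgraph_free (complete_graph r) ?G"
    by (auto simp: subgraph_free_def contains_subgraph_def)
  moreover have "finite_simple_graph ?G" "card (verts ?G) = n"
    by (auto simp: finite_simple_graph_def)
  ultimately show ?thesis by blast
qed

lemma edge_obtain:
  assumes "finite_simple_graph G" "e \<in> edges G"
  obtains u v where "e = {u, v}" "u \<noteq> v" "u \<in> verts G" "v \<in> verts G"
  using assms unfolding finite_simple_graph_def by (meson nsets2_E subsetD)

lemma h_graph_le_h_max:
  fixes G :: "'a graph" and H :: "'b graph"
  assumes G: "finite_simple_graph G" and free: "subgraph_free H G" and k: "k > 0"
  shows "h_graph G k \<le> h_max (card (verts G)) k H"
proof -
  have "finite (verts G)" using G by (simp add: finite_simple_graph_def)
  from finite_imp_inj_to_nat_seg[OF this] obtain f :: "'a \<Rightarrow> nat" where f: "inj_on f (verts G)"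
    by auto
  define g where "g = inv_into (verts G) f"
  have gf: "g (f x) = x" if "x \<in> verts G" for x
    using that f by (simp add: g_def)
  have sub: "e \<subseteq> verts G" if "e \<in> edges G" for e
    using that G by (auto simp: finite_simple_graph_def nsets_def)
  have gfe: "g ` f ` e = e" if "e \<in> edges G" for e
  proof -
    have "g ` f ` e = (\<lambda>x. x) ` e"
      unfolding image_image using gf sub[OF that] by (intro image_cong) auto
    then show ?thesis by simp
  qed
  define G' where "G' = \<lparr>verts = f ` verts G, edges = (`) f ` edges G\<rparr>"
  have G': "finite_simple_graph G'"
    unfolding finite_simple_graph_def
  proof
    show "edges G' \<subseteq> [verts G']\<^bsup>2\<^esup>"
    proof
      fix e' assume "e' \<in> edges G'"
      then obtain e where e: "e \<in> edges G" "e' = f ` e" by (auto simp: G'_def)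
      from edge_obtain[OF G e(1)] obtain u v
        where "e = {u, v}" "u \<noteq> v" "u \<in> verts G" "v \<in> verts G" .
      with e f show "e' \<in> [verts G']\<^bsup>2\<^esup>"
        by (auto simp: G'_def inj_on_eq_iff)
    qed
  qed (use G in \<open>simp add: G'_def finite_simple_graph_def\<close>)
  have card': "card (verts G') = card (verts G)"
    using f by (simp add: G'_def card_image)
  have free': "subgraph_free H G'"
    unfolding subgraph_free_def contains_subgraph_def
  proof clarify
    fix \<phi> assume \<phi>: "inj_on \<phi> (verts H)" "\<phi> ` verts H \<subseteq> verts G'"
      "\<forall>e\<in>edges H. \<phi> ` e \<in> edges G'"
    have "inj_on (g \<circ> \<phi>) (verts H)"
    proof (rule comp_inj_on[OF \<phi>(1)])
      show "inj_on g (\<phi> ` verts H)"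
        using \<phi>(2) unfolding g_def G'_def by (intro inj_on_inv_into) simp
    qed
    moreover have "(g \<circ> \<phi>) ` verts H \<subseteq> verts G"
    proof clarify
      fix x assume "x \<in> verts H"
      with \<phi>(2) obtain y where "y \<in> verts G" "\<phi> x = f y" by (auto simp: G'_def)
      then show "(g \<circ> \<phi>) x \<in> verts G" using gf by simp
    qed
    moreover have "(g \<circ> \<phi>) ` e \<in> edges G" if "e \<in> edges H" for e
    proof -
      from \<phi>(3) that obtain d where d: "d \<in> edges G" "\<phi> ` e = f ` d"
        by (auto simp: G'_def)
      then have "(g \<circ> \<phi>) ` e = d" using gfe[OF d(1)] by (simp only: image_comp[symmetric] d(2))
      with d(1) show ?thesis by simp
    qed
    ultimately show False
      using free unfolding subgraph_free_def contains_subgraph_def by blast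
  qed
  have "h_graph G k \<le> h_graph G' k"
  proof -
    have "h_graph G' k \<in> {card F | F. F \<subseteq> edges G' \<and> colorable k (delete_edges G' F)}"
      unfolding h_graph_def
      by (rule Min_in[OF finite_deletion_sizes[OF G'] deletion_sizes_nonempty[OF k]])
    then obtain F' where F': "h_graph G' k = card F'" "F' \<subseteq> edges G'"
      "colorable k (delete_edges G' F')" by blast
    from F'(3) obtain c where c: "c ` verts G' \<subseteq> {..<k}"
      "\<And>u v. {u, v} \<in> edges G' - F' \<Longrightarrow> c u \<noteq> c v"
      by (auto simp: colorable_def delete_edges_def)
    define F where "F = {e \<in> edges G. f ` e \<in> F'}"
    have inj: "inj_on ((`) f) (edges G)"
      by (rule inj_on_inverseI[where g = "(`) g"]) (rule gfe)
    have "card F = card ((`) f ` F)"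
      by (rule card_image[symmetric], rule inj_on_subset[OF inj]) (auto simp: F_def)
    also have "(`) f ` F = F'"
      using F'(2) by (auto simp: F_def G'_def)
    finally have "h_graph G' k = card F" using F'(1) by simp
    moreover have "colorable k (delete_edges G F)"
      unfolding colorable_def
    proof (intro exI[of _ "c \<circ> f"] conjI allI impI)
      show "(c \<circ> f) ` verts (delete_edges G F) \<subseteq> {..<k}"
        using c(1) by (auto simp: delete_edges_def G'_def)
      fix u v assume "{u, v} \<in> edges (delete_edges G F)"
      then have e: "{u, v} \<in> edges G" "f ` {u, v} \<notin> F'"
        by (auto simp: delete_edges_def F_def)
      from imageI[OF e(1), of "(`) f"] e(2) have "f ` {u, v} \<in> edges G' - F'"
        by (simp add: G'_def)
      then have "{f u, f v} \<in> edges G' - F'" by simp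
      then show "(c \<circ> f) u \<noteq> (c \<circ> f) v" using c(2) by simp
    qed
    moreover have "F \<subseteq> edges G" by (auto simp: F_def)
    ultimately show ?thesis
      unfolding h_graph_def[of G] by (intro Min_le finite_deletion_sizes[OF G]) blast
  qed
  also have "h_graph G' k \<le> h_max (card (verts G)) k H"
    unfolding h_max_def by (rule Max_ge[OF finite_h_values[OF k]]) (use G' card' free' in blast)
  finally show ?thesis .
qed

end

theory Submission
  imports Defs
begin

text \<open>
  Write \<open>r = s + 2\<close> and \<open>k \<approx> (s + 1) m^s\<close>, and induct on \<open>s\<close>. As long as
  some vertex has \<open>d = \<lfloor>n / m\<rfloor> + 1\<close> neighbours among the remaining vertices, remove a set of
  exactly \<open>d\<close> of them. Such a set spans no \<open>K_(r - 1)\<close>, so by induction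
  \<open>s m^(s - 1)\<close> colours of its own leave \<open>O(d^2 / m^s)\<close> monochromatic edges in it. There are at
  most \<open>m\<close> removals, which yields \<open>O(n^2 / m^(s + 1))\<close> monochromatic edges in total. In the rest
  all degrees are at most \<open>d\<close>, and a greedy colouring with \<open>m^s\<close> further colours leaves at most
  \<open>n d / m^s\<close> monochromatic edges.
\<close>

section \<open>Colorings with few monochromatic edges\<close>

definition mono_edges :: "'a set set \<Rightarrow> 'a set \<Rightarrow> ('a \<Rightarrow> nat) \<Rightarrow> 'a set set" where
  "mono_edges E W c = {e \<in> E. e \<subseteq> W \<and> (\<exists>i. c ` e \<subseteq> {i})}"

text \<open>The edge set stays fixed while \<open>W\<close> varies, so the recursion passes to
  vertex subsets without forming induced subgraphs. The error \<open>x\<close> is real because the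
  bounds on it are quotients.\<close>

definition nearly_colorable :: "'a set set \<Rightarrow> 'a set \<Rightarrow> nat \<Rightarrow> real \<Rightarrow> bool" where
  "nearly_colorable E W k x \<longleftrightarrow>
     (\<exists>c. c ` W \<subseteq> {..<k} \<and> real (card (mono_edges E W c)) \<le> x)"

definition nbrs :: "'a set set \<Rightarrow> 'a set \<Rightarrow> 'a \<Rightarrow> 'a set" where
  "nbrs E W v = {u \<in> W. {v, u} \<in> E}"

definition clique_free :: "'a set set \<Rightarrow> nat \<Rightarrow> 'a set \<Rightarrow> bool" where
  "clique_free E t W \<longleftrightarrow> \<not> (\<exists>K \<subseteq> W. card K = t \<and> finite K \<and> [K]\<^bsup>2\<^esup> \<subseteq> E)"

lemma finite_mono_edges: "finite W \<Longrightarrow> finite (mono_edges E W c)"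
  by (rule finite_subset[of _ "Pow W"]) (auto simp: mono_edges_def)

lemma mono_edges_obtain:
  assumes "E \<subseteq> [V]\<^bsup>2\<^esup>" "e \<in> mono_edges E W c"
  obtains u v where "e = {u, v}" "u \<noteq> v" "u \<in> W" "v \<in> W" "c u = c v"
proof -
  have "e \<in> [V]\<^bsup>2\<^esup>" using assms by (auto simp: mono_edges_def)
  then obtain u v where uv: "e = {u, v}" "u \<noteq> v" by (blast elim: nsets2_E)
  with assms(2) show ?thesis by (intro that[of u v]) (auto simp: mono_edges_def)
qed

lemma finite_nbrs: "finite W \<Longrightarrow> finite (nbrs E W v)"
  by (simp add: nbrs_def)

lemma nearly_colorable_mono:
  assumes "nearly_colorable E W k x" "k \<le> k'" "x \<le> x'"
  shows "nearly_colorable E W k' x'"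
  using assms unfolding nearly_colorable_def by (meson lessThan_subset_iff order_trans)

text \<open>The two palettes are made disjoint by shifting the second by \<open>k\<close>. An edge
  with a single color then lies entirely in \<open>W\<close> or entirely in \<open>W'\<close>, so
  edges between the two parts cost nothing and the errors add.\<close>

lemma nearly_colorable_Un:
  assumes E: "{} \<notin> E" and fin: "finite W" "finite W'"
    and W: "nearly_colorable E W k x" and W': "nearly_colorable E W' k' x'"
  shows "nearly_colorable E (W \<union> W') (k + k') (x + x')"
proof -
  obtain c where c: "c ` W \<subseteq> {..<k}" "real (card (mono_edges E W c)) \<le> x"
    using W unfolding nearly_colorable_def by blast
  obtain c' where c': "c' ` W' \<subseteq> {..<k'}" "real (card (mono_edges E W' c')) \<le> x'"
    using W' unfolding nearly_colorable_def by blast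
  define b where "b v = (if v \<in> W then c v else k + c' v)" for v
  have "mono_edges E (W \<union> W') b \<subseteq> mono_edges E W c \<union> mono_edges E W' c'"
  proof
    fix e assume "e \<in> mono_edges E (W \<union> W') b"
    then obtain i where e: "e \<in> E" "e \<subseteq> W \<union> W'" and "b ` e \<subseteq> {i}"
      by (auto simp: mono_edges_def)
    then have i: "b v = i" if "v \<in> e" for v using that by auto
    obtain u where u: "u \<in> e" using E e(1) by (metis ex_in_conv)
    show "e \<in> mono_edges E W c \<union> mono_edges E W' c'"
    proof (cases "i < k")
      case True
      have "v \<in> W \<and> c v = i" if "v \<in> e" for v
        using i[OF that] True by (auto simp: b_def split: if_splits)
      with e show ?thesis by (fastforce simp: mono_edges_def)
    next
      case False
      have "v \<in> W' \<and> c' v = i - k" if "v \<in> e" for v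
        using i[OF that] False c(1) e(2) that by (auto simp: b_def split: if_splits)
      with e show ?thesis by (fastforce simp: mono_edges_def)
    qed
  qed
  then have "card (mono_edges E (W \<union> W') b) \<le> card (mono_edges E W c \<union> mono_edges E W' c')"
    by (intro card_mono finite_UnI finite_mono_edges fin)
  also have "\<dots> \<le> card (mono_edges E W c) + card (mono_edges E W' c')"
    by (rule card_Un_le)
  finally have "real (card (mono_edges E (W \<union> W') b)) \<le> x + x'"
    using c(2) c'(2) by linarith
  moreover have "b ` (W \<union> W') \<subseteq> {..<k + k'}"
    using c(1) c'(1) by (fastforce simp: b_def)
  ultimately show ?thesis unfolding nearly_colorable_def by blast
qed

text \<open>Every vertex gets a color of its own; this settles vertex sets that are small compared
  with the palette.\<close>

lemma nearly_colorable_card: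
  assumes "finite W" "E \<subseteq> [V]\<^bsup>2\<^esup>"
  shows "nearly_colorable E W (card W) 0"
proof -
  obtain c where c: "c ` W = {..<card W}" "inj_on c W"
    using ex_bij_betw_finite_nat[OF assms(1)] by (auto simp: bij_betw_def atLeast0LessThan)
  have "mono_edges E W c = {}"
  proof (intro equals0I)
    fix e assume e: "e \<in> mono_edges E W c"
    obtain u v where "u \<noteq> v" "u \<in> W" "v \<in> W" "c u = c v"
      using mono_edges_obtain[OF assms(2) e] .
    with c(2) show False by (auto simp: inj_on_def)
  qed
  with c(1) show ?thesis unfolding nearly_colorable_def by (intro exI[of _ c]) auto
qed

text \<open>Base case of the induction on the clique size: an edge inside \<open>W\<close> would
  itself be a clique of size 2.\<close>

lemma nearly_colorable_clique_free_2:
  assumes "E \<subseteq> [V]\<^bsup>2\<^esup>" "clique_free E 2 W"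
  shows "nearly_colorable E W 1 0"
proof -
  have "mono_edges E W (\<lambda>_. 0) = {}"
  proof (intro equals0I)
    fix e assume e: "e \<in> mono_edges E W (\<lambda>_. 0)"
    obtain u v where "e = {u, v}" "u \<noteq> v"
      using mono_edges_obtain[OF assms(1) e] .
    moreover have "[e]\<^bsup>2\<^esup> = {e}" if "card e = 2" "finite e"
      using that by (auto simp: nsets_def dest: card_subset_eq)
    ultimately have "[e]\<^bsup>2\<^esup> = {e}" "card e = 2" "finite e" by simp_all
    then show False using assms(2) e
      by (auto simp: clique_free_def mono_edges_def)
  qed
  then show ?thesis unfolding nearly_colorable_def by (intro exI[of _ "\<lambda>_. 0"]) auto
qed

text \<open>Adding \<open>v\<close> to a clique among its neighbors enlarges the clique by one. The
  assumption on \<open>{v}\<close> keeps \<open>v\<close> out of its own neighborhood, as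
  \<open>{v, v} = {v}\<close>.\<close>

lemma clique_free_nbrs:
  assumes "clique_free E (Suc t) W" "v \<in> W" "{v} \<notin> E"
  shows "clique_free E t (nbrs E W v)"
  unfolding clique_free_def
proof clarify
  fix K assume K: "K \<subseteq> nbrs E W v" "finite K" "[K]\<^bsup>2\<^esup> \<subseteq> E" "t = card K"
  have "v \<notin> K" using K(1) assms(3) by (auto simp: nbrs_def)
  moreover have "[insert v K]\<^bsup>2\<^esup> \<subseteq> E"
  proof
    fix e assume "e \<in> [insert v K]\<^bsup>2\<^esup>"
    then obtain a b where ab: "e = {a, b}" "a \<noteq> b" "a \<in> insert v K" "b \<in> insert v K"
      by (blast elim: nsets2_E)
    have "{v, u} \<in> E" if "u \<in> K" for u using that K(1) by (auto simp: nbrs_def)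
    moreover have "{a, b} \<in> E" if "a \<in> K" "b \<in> K" using that ab(2) K(3) by auto
    ultimately show "e \<in> E" using ab by (auto simp: insert_commute)
  qed
  moreover have "insert v K \<subseteq> W" using assms(2) K(1) by (auto simp: nbrs_def)
  ultimately show False
    using assms(1) K(2,4) unfolding clique_free_def
    by (metis card_insert_disjoint finite_insert)
qed

lemma clique_free_subset: "clique_free E t W \<Longrightarrow> S \<subseteq> W \<Longrightarrow> clique_free E t S"
  unfolding clique_free_def by blast

section \<open>Greedy coloring\<close>

text \<open>Averaging: the \<open>k\<close> color classes partition \<open>N\<close>, so they cannot
  all exceed the mean size.\<close>

lemma exists_rare_color:
  assumes N: "finite N" "c ` N \<subseteq> {..<k}" and k: "k > 0"
  shows "\<exists>i<k. k * card {u \<in> N. c u = i} \<le> card N"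
proof (rule ccontr)
  assume "\<not> ?thesis"
  then have "card N < k * card {u \<in> N. c u = i}" if "i < k" for i
    using that by (meson not_le)
  then have "(\<Sum>i<k. card N) < (\<Sum>i<k. k * card {u \<in> N. c u = i})"
    using k by (intro sum_strict_mono) auto
  also have "\<dots> = k * (\<Sum>i<k. card {u \<in> N. c u = i})"
    by (simp add: sum_distrib_left)
  also have "(\<Sum>i<k. card {u \<in> N. c u = i}) = card N"
    using sum.group[of N "{..<k}" c "\<lambda>_. 1 :: nat"] N by simp
  finally show False by simp
qed

text \<open>Vertices are added one at a time, each with the color rarest among its neighbors already
  present. Each step creates at most \<open>d / k\<close> monochromatic edges.\<close>

lemma greedy_coloring:
  assumes "finite W" and E: "E \<subseteq> [V]\<^bsup>2\<^esup>" and k: "k > 0"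
    and "\<And>v. v \<in> W \<Longrightarrow> card (nbrs E W v) \<le> d"
  shows "nearly_colorable E W k (real (card W) * real d / real k)"
proof -
  \<comment> \<open>Clearing the denominator keeps the induction within the natural numbers.\<close>
  have "\<exists>c. c ` W \<subseteq> {..<k} \<and> k * card (mono_edges E W c) \<le> card W * d"
    using assms(1,4)
  proof (induction W)
    case empty
    have "mono_edges E {} c = {}" for c :: "'a \<Rightarrow> nat"
      using E by (auto simp: mono_edges_def nsets_def)
    then show ?case by auto
  next
    case (insert v W)
    have "card (nbrs E W w) \<le> d" if "w \<in> insert v W" for w
    proof -
      have "card (nbrs E W w) \<le> card (nbrs E (insert v W) w)"
        using insert.hyps by (intro card_mono finite_nbrs) (auto simp: nbrs_def)
      with insert.prems[OF that] show ?thesis by linarith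
    qed
    with insert.IH obtain c where c: "c ` W \<subseteq> {..<k}" "k * card (mono_edges E W c) \<le> card W * d"
      and d: "card (nbrs E W v) \<le> d" by (metis insertI1 insertI2)
    have "c ` nbrs E W v \<subseteq> {..<k}" using c(1) by (auto simp: nbrs_def)
    from exists_rare_color[OF finite_nbrs[OF insert.hyps(1)] this k] obtain i
      where i: "i < k" "k * card {u \<in> nbrs E W v. c u = i} \<le> card (nbrs E W v)" by blast
    define U where "U = {u \<in> nbrs E W v. c u = i}"
    \<comment> \<open>Recoloring affects only edges through \<open>v\<close>, and such an edge is
      monochromatic only if its other end lies in \<open>U\<close>.\<close>
    have "mono_edges E (insert v W) (c(v := i)) \<subseteq> mono_edges E W c \<union> (\<lambda>u. {v, u}) ` U"
    proof
      fix e assume e: "e \<in> mono_edges E (insert v W) (c(v := i))"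
      obtain a b where ab: "e = {a, b}" "a \<noteq> b"
        using mono_edges_obtain[OF E e] .
      consider "v \<notin> e" | u where "e = {v, u}" "u \<noteq> v"
        using ab by (metis doubleton_eq_iff insertE singletonD)
      then show "e \<in> mono_edges E W c \<union> (\<lambda>u. {v, u}) ` U"
      proof cases
        case 1
        then have "(c(v := i)) ` e = c ` e" by (intro image_cong) auto
        with 1 e show ?thesis by (auto simp: mono_edges_def)
      next
        case 2
        with e have "u \<in> U" by (auto simp: mono_edges_def U_def nbrs_def)
        with 2 show ?thesis by auto
      qed
    qed
    moreover have fU: "finite U" using insert.hyps by (simp add: U_def nbrs_def)
    ultimately have "card (mono_edges E (insert v W) (c(v := i)))
        \<le> card (mono_edges E W c \<union> (\<lambda>u. {v, u}) ` U)"
      using insert.hyps by (intro card_mono) (auto simp: finite_mono_edges)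
    also have "\<dots> \<le> card (mono_edges E W c) + card U"
      by (intro order.trans[OF card_Un_le] add_left_mono card_image_le fU)
    finally have "k * card (mono_edges E (insert v W) (c(v := i)))
        \<le> k * card (mono_edges E W c) + k * card U"
      by (metis distrib_left mult_le_mono2)
    also have "\<dots> \<le> card (insert v W) * d"
      using c(2) i(2) d insert.hyps by (simp add: U_def)
    finally have le: "k * card (mono_edges E (insert v W) (c(v := i))) \<le> card (insert v W) * d" .
    have "(c(v := i)) ` insert v W \<subseteq> {..<k}" using c(1) i(1) by auto
    with le show ?case by blast
  qed
  then obtain c where "c ` W \<subseteq> {..<k}" "k * card (mono_edges E W c) \<le> card W * d" by blast
  moreover from this(2) have "real k * real (card (mono_edges E W c)) \<le> real (card W) * real d"
    by (metis of_nat_le_iff of_nat_mult)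
  ultimately show ?thesis
    using k unfolding nearly_colorable_def
    by (intro exI[of _ c]) (simp add: field_simps)
qed

section \<open>Peeling off neighborhoods and the induction on the clique size\<close>

text \<open>Here \<open>j\<close> bounds the number of removals still possible, since each takes
  exactly \<open>d\<close> vertices. Every removal pays for \<open>q\<close> fresh colors and an
  error \<open>x\<close>; the other \<open>l\<close> colors are reserved for the low-degree
  remainder.\<close>

lemma peel_neighborhoods:
  assumes E: "E \<subseteq> [V]\<^bsup>2\<^esup>" and l: "l > 0" and x: "x \<ge> 0"
    and S: "\<And>v S. v \<in> W \<Longrightarrow> S \<subseteq> nbrs E W v \<Longrightarrow> card S = d \<Longrightarrow> nearly_colorable E S q x"
    and "finite W" "card W \<le> d * j"
  shows "nearly_colorable E W (j * q + l) (real j * x + real (card W) * real d / real l)"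
  using S assms(5-)
proof (induction j arbitrary: W)
  case 0
  then have "W = {}" by simp
  then show ?case
    using greedy_coloring[of W, OF _ E l, of 0] by simp
next
  case (Suc j)
  have 0: "{} \<notin> E" using E by (auto simp: nsets_def)
  show ?case
  proof (cases "\<forall>v\<in>W. card (nbrs E W v) \<le> d")
    case True
    then have "nearly_colorable E W l (real (card W) * real d / real l)"
      using greedy_coloring[OF Suc.prems(2) E l] by blast
    then show ?thesis
      \<comment> \<open>Peeling stops early: the palettes and errors budgeted for further removals
        are left over.\<close>
      by (rule nearly_colorable_mono) (use x in auto)
  next
    case False
    then obtain v where v: "v \<in> W" "d \<le> card (nbrs E W v)" by force
    then obtain S where S: "S \<subseteq> nbrs E W v" "card S = d"
      using obtain_subset_with_card_n by metis
    have SW: "S \<subseteq> W" using S(1) by (auto simp: nbrs_def)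
    have finS: "finite S" using SW Suc.prems(2) by (rule finite_subset)
    have "card (W - S) = card W - d"
      using card_Diff_subset[OF finS SW] S(2) by simp
    with Suc.prems(3) have le: "card (W - S) \<le> d * j" "card (W - S) \<le> card W" by auto
    have "nearly_colorable E (W - S) (j * q + l)
        (real j * x + real (card (W - S)) * real d / real l)"
    proof (rule Suc.IH[OF _ _ le(1)])
      \<comment> \<open>Neighbors within \<open>W - S\<close> are neighbors within \<open>W\<close>,
        so the hypothesis on small sets is inherited.\<close>
      fix v T assume "v \<in> W - S" "T \<subseteq> nbrs E (W - S) v" "card T = d"
      then show "nearly_colorable E T q x"
        by (intro Suc.prems(1)[of v]) (auto simp: nbrs_def)
    qed (use Suc.prems(2) in simp)
    from nearly_colorable_Un[OF 0 finS _ Suc.prems(1)[OF v(1) S] this] Suc.prems(2)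
    have "nearly_colorable E (S \<union> (W - S)) (q + (j * q + l))
        (x + (real j * x + real (card (W - S)) * real d / real l))"
      by simp
    moreover have "S \<union> (W - S) = W" using SW by blast
    moreover have "real (card (W - S)) * real d / real l \<le> real (card W) * real d / real l"
      using le(2) by (intro divide_right_mono mult_right_mono) auto
    ultimately show ?thesis
      by (auto elim!: nearly_colorable_mono simp: algebra_simps)
  qed
qed

text \<open>The coefficient \<open>4 ^ s - 1\<close> solves the recurrence
  \<open>B' = 4 * B + 3\<close> with initial value 0. The factor 4 is the square of the 2 in
  \<open>d <= 2 * n / m\<close>, and the 3 covers the greedy term.\<close>

lemma nearly_colorable_clique_free:
  assumes E: "E \<subseteq> [V]\<^bsup>2\<^esup>" and "finite W" "clique_free E (s + 2) W" "m > 0"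
  shows "nearly_colorable E W (Suc s * m ^ s) ((4 ^ s - 1) * real (card W) ^ 2 / real m ^ Suc s)"
  using assms(2-)
proof (induction s arbitrary: W)
  case 0
  then show ?case using nearly_colorable_clique_free_2[OF E] by (simp add: numeral_2_eq_2)
next
  case (Suc s)
  define B :: real where "B = 4 ^ s - 1"
  have B: "B \<ge> 0" by (simp add: B_def)
  have target: "(4 ^ Suc s - 1 :: real) = 4 * B + 3" by (simp add: B_def)
  define n where "n = card W"
  show ?case
  \<comment> \<open>For \<open>n <= m\<close> there are enough colors for all vertices. Otherwise
    \<open>1 <= n / m\<close>, which absorbs the rounding in \<open>d\<close>.\<close>
  proof (cases "n \<le> m")
    case True
    have "m * 1 \<le> m * (Suc (Suc s) * m ^ s)"
      using Suc.prems(3) by (intro mult_le_mono2) (simp add: Suc_leI)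
    then have "n \<le> Suc (Suc s) * m ^ Suc s"
      using True by (simp add: algebra_simps)
    then show ?thesis
      unfolding target n_def
      by (rule nearly_colorable_mono[OF nearly_colorable_card[OF Suc.prems(1) E]]) (use B in simp)
  next
    case False
    \<comment> \<open>The added 1 ensures \<open>n <= d * m\<close>, so \<open>m\<close> removals
      exhaust \<open>W\<close>.\<close>
    define d where "d = n div m + 1"
    have jd: "n \<le> d * m"
      using dividend_less_div_times[OF Suc.prems(3), of n] by (simp add: d_def)
    have "real d \<le> real n / real m + 1"
      using of_nat_div_le_of_nat[of n m, where 'a = real] by (simp add: d_def)
    also have "1 \<le> real n / real m" using False Suc.prems(3) by simp
    finally have d: "real d \<le> 2 * real n / real m" by simp
    define x where "x = B * real d ^ 2 / real m ^ Suc s"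
    have x: "x \<ge> 0" using B by (simp add: x_def)
    \<comment> \<open>Peeling with \<open>j = m\<close>, \<open>q = Suc s * m ^ s\<close> and
      \<open>l = m ^ Suc s\<close> uses \<open>(s + 2) * m ^ Suc s\<close> colors, as the induction
      step demands.\<close>
    have "nearly_colorable E W (m * (Suc s * m ^ s) + m ^ Suc s)
        (real m * x + real (card W) * real d / real (m ^ Suc s))"
    proof (rule peel_neighborhoods[OF E _ x _ Suc.prems(1) jd[unfolded n_def]])
      fix v S assume S: "v \<in> W" "S \<subseteq> nbrs E W v" "card S = d"
      have "{v} \<notin> E" using E by (auto simp: nsets_def)
      then have "clique_free E (s + 2) (nbrs E W v)"
        using clique_free_nbrs Suc.prems(2) S(1) by auto
      then have "clique_free E (s + 2) S" using S(2) by (rule clique_free_subset)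
      moreover have "finite S"
        using S(2) finite_nbrs[OF Suc.prems(1)] by (rule finite_subset)
      ultimately show "nearly_colorable E S (Suc s * m ^ s) x"
        using Suc.IH[of S] Suc.prems(3) S(3) by (simp add: x_def B_def)
    qed (use Suc.prems(3) in simp)
    moreover have "real m * x + real (card W) * real d / real (m ^ Suc s)
        \<le> (4 * B + 3) * real n ^ 2 / real m ^ Suc (Suc s)"
    proof -
      have m: "real m > 0" using Suc.prems(3) by simp
      have "real d ^ 2 \<le> (2 * real n / real m) ^ 2" using d by (intro power_mono) auto
      then have "real m * x \<le> real m * (B * (2 * real n / real m) ^ 2 / real m ^ Suc s)"
        unfolding x_def using B by (intro mult_left_mono divide_right_mono) auto
      also have "\<dots> = 4 * B * real n ^ 2 / real m ^ Suc (Suc s)"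
        using m by (simp add: field_simps power2_eq_square)
      finally have 1: "real m * x \<le> 4 * B * real n ^ 2 / real m ^ Suc (Suc s)" .
      have "real (card W) * real d / real (m ^ Suc s)
          \<le> real n * (2 * real n / real m) / real m ^ Suc s"
        unfolding n_def[symmetric] of_nat_power using d
        by (intro divide_right_mono mult_left_mono) auto
      also have "\<dots> = 2 * real n ^ 2 / real m ^ Suc (Suc s)"
        using m by (simp add: field_simps power2_eq_square)
      \<comment> \<open>The coefficient 2 is raised to 3 to fit the closed form of the
        recurrence.\<close>
      also have "\<dots> \<le> 3 * real n ^ 2 / real m ^ Suc (Suc s)"
        by (intro divide_right_mono) auto
      finally show ?thesis using 1 by (simp add: algebra_simps add_divide_distrib)
    qed
    ultimately show ?thesis
      unfolding target n_def
      by (elim nearly_colorable_mono) (simp_all add: algebra_simps)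
  qed
qed

section \<open>From near-colorings to edge deletions, for arbitrary \<open>k\<close>\<close>

lemma subgraph_free_complete_graph_imp_clique_free:
  assumes "subgraph_free (complete_graph r) G"
  shows "clique_free (edges G) r (verts G)"
  unfolding clique_free_def
proof clarify
  fix K assume K: "K \<subseteq> verts G" "r = card K" "finite K" "[K]\<^bsup>2\<^esup> \<subseteq> edges G"
  obtain f where f: "bij_betw f {..<r} K"
    using ex_bij_betw_nat_finite[OF K(3)] K(2) by (auto simp: atLeast0LessThan)
  have "f ` e \<in> edges G" if e: "e \<in> [{..<r}]\<^bsup>2\<^esup>" for e
  proof -
    obtain a b where "e = {a, b}" "a \<noteq> b" "a < r" "b < r"
      using nsets2_E[OF e] by (metis lessThan_iff)
    then have "f ` e \<in> [K]\<^bsup>2\<^esup>"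
      using f by (auto simp: bij_betw_def inj_on_def)
    then show ?thesis using K(4) by blast
  qed
  then have "contains_subgraph G (complete_graph r)"
    using f K(1) unfolding contains_subgraph_def complete_graph_def bij_betw_def by auto
  with assms show False by (simp add: subgraph_free_def)
qed

text \<open>Deleting the monochromatic edges makes the coloring proper.\<close>

lemma h_graph_le_of_nearly_colorable:
  assumes G: "finite_simple_graph G" and x: "nearly_colorable (edges G) (verts G) k x"
  shows "real (h_graph G k) \<le> x"
proof -
  obtain c where c: "c ` verts G \<subseteq> {..<k}"
    "real (card (mono_edges (edges G) (verts G) c)) \<le> x"
    using x unfolding nearly_colorable_def by blast
  let ?F = "mono_edges (edges G) (verts G) c"
  have "colorable k (delete_edges G ?F)"
    unfolding colorable_def
  proof (intro exI[of _ c] conjI allI impI)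
    fix u v assume uv: "{u, v} \<in> edges (delete_edges G ?F)"
    moreover have "{u, v} \<subseteq> verts G"
      using uv G by (fastforce simp: delete_edges_def finite_simple_graph_def nsets_def)
    ultimately show "c u \<noteq> c v"
      by (auto simp: delete_edges_def mono_edges_def)
  qed (use c(1) in \<open>simp add: delete_edges_def\<close>)
  moreover have "?F \<subseteq> edges G" by (auto simp: mono_edges_def)
  ultimately have "h_graph G k \<le> card ?F"
    unfolding h_graph_def by (intro Min_le finite_deletion_sizes[OF G]) blast
  with c(2) show ?thesis by linarith
qed

text \<open>An integer \<open>m\<close> within a factor 2 of the \<open>s\<close>-th root of
  \<open>k / a\<close>, except that \<open>m = 1\<close> is taken when \<open>k < a\<close>. The
  factor 2 comes from \<open>Suc M <= 2 * max 1 M\<close>.\<close>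

lemma exists_root_approximation:
  fixes a k s :: nat
  assumes "s > 0" "a > 0"
  shows "\<exists>m>0. (a * m ^ s \<le> k \<or> m = 1) \<and> k \<le> a * (2 * m) ^ s"
proof -
  define M where "M = (GREATEST m. a * m ^ s \<le> k)"
  have bound: "m \<le> k" if "a * m ^ s \<le> k" for m
  proof -
    have "m \<le> m ^ s" using assms(1) by (cases "m = 0") (auto intro: self_le_power)
    also have "\<dots> \<le> a * m ^ s" using assms(2) by simp
    finally show ?thesis using that by linarith
  qed
  \<comment> \<open>The value 0 always qualifies because \<open>s > 0\<close>; with the upper bound
    \<open>k\<close> this makes the greatest value well defined.\<close>
  have "a * 0 ^ s \<le> k" using assms(1) by (simp add: zero_power)
  then have M: "a * M ^ s \<le> k"
    unfolding M_def by (rule GreatestI_nat[of "\<lambda>m. a * m ^ s \<le> k"]) (rule bound)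
  have "\<not> a * Suc M ^ s \<le> k"
  proof
    assume "a * Suc M ^ s \<le> k"
    then have "Suc M \<le> M"
      unfolding M_def by (rule Greatest_le_nat[of "\<lambda>m. a * m ^ s \<le> k"]) (rule bound)
    then show False by simp
  qed
  moreover have "a * Suc M ^ s \<le> a * (2 * max 1 M) ^ s"
    by (intro mult_le_mono2 power_mono) auto
  ultimately have "k \<le> a * (2 * max 1 M) ^ s" by linarith
  moreover have "a * max 1 M ^ s \<le> k \<or> max 1 M = 1"
    using M by (cases "M \<le> 1") (auto simp: max_def)
  ultimately show ?thesis by (intro exI[of _ "max 1 M"]) simp
qed

text \<open>Arbitrary \<open>k\<close> is reduced to a palette of the form
  \<open>Suc s * m ^ s\<close>. The upper bound on \<open>k\<close> in terms of \<open>m\<close>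
  then turns the error into a power of \<open>k\<close>, at the price of a constant depending on
  \<open>s\<close> alone.\<close>

lemma h_graph_complete_free_le:
  fixes G :: "'a graph"
  assumes G: "finite_simple_graph G" and free: "subgraph_free (complete_graph (s + 2)) G"
    and s: "s > 0" and k: "k > 0"
  shows "real (h_graph G k) \<le> 4 ^ s * (real (Suc s) * 2 ^ s) powr (real (Suc s) / real s) *
    (real (card (verts G)) ^ 2 / real k powr (real (Suc s) / real s))"
proof -
  let ?n = "real (card (verts G))" and ?p = "real (Suc s) / real s"
  have fin: "finite (verts G)" and E: "edges G \<subseteq> [verts G]\<^bsup>2\<^esup>"
    using G by (auto simp: finite_simple_graph_def)
  obtain m where m: "m > 0" "Suc s * m ^ s \<le> k \<or> m = 1" "k \<le> Suc s * (2 * m) ^ s"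
    using exists_root_approximation[OF s zero_less_Suc[of s], of k] by (elim exE conjE)
  have "nearly_colorable (edges G) (verts G) k (4 ^ s * ?n ^ 2 / real m ^ Suc s)"
  proof (cases "Suc s * m ^ s \<le> k")
    case True
    have "(4 ^ s - 1) * ?n ^ 2 / real m ^ Suc s \<le> 4 ^ s * ?n ^ 2 / real m ^ Suc s"
      by (intro divide_right_mono mult_right_mono) auto
    then show ?thesis
      using nearly_colorable_mono[OF nearly_colorable_clique_free[OF E fin _ m(1), of s] True]
        subgraph_free_complete_graph_imp_clique_free[OF free] by blast
  next
    case False
    have "card (nbrs (edges G) (verts G) v) \<le> card (verts G)" for v
      using fin by (intro card_mono) (auto simp: nbrs_def)
    then have "nearly_colorable (edges G) (verts G) 1 (?n ^ 2)"
      using greedy_coloring[OF fin E, of 1] by (simp add: power2_eq_square)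
    moreover have "1 * ?n ^ 2 \<le> 4 ^ s * ?n ^ 2"
      by (intro mult_right_mono) auto
    ultimately show ?thesis
      using k m(2) False by (auto elim!: nearly_colorable_mono)
  qed
  from h_graph_le_of_nearly_colorable[OF G this]
  have h: "real (h_graph G k) \<le> 4 ^ s * ?n ^ 2 / real m ^ Suc s" .
  have "real k \<le> (real (Suc s) * 2 ^ s) * real m ^ s"
    using m(3)[folded of_nat_le_iff[where 'a = real]]
    by (simp only: of_nat_mult of_nat_power power_mult_distrib of_nat_numeral mult.assoc)
  then have "real k powr ?p \<le> ((real (Suc s) * 2 ^ s) * real m ^ s) powr ?p"
    by (intro powr_mono2) auto
  also have "\<dots> = (real (Suc s) * 2 ^ s) powr ?p * (real m ^ s) powr ?p"
    by (rule powr_mult)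
  \<comment> \<open>The exponent \<open>?p\<close> is chosen to convert \<open>m ^ s\<close>, the
    scale of the palette, into \<open>m ^ Suc s\<close>, the scale of the error.\<close>
  also have "(real m ^ s) powr ?p = real m ^ Suc s"
    using m(1) s by (simp add: powr_realpow[symmetric] powr_powr del: of_nat_Suc power_Suc)
  finally have "real k powr ?p \<le> (real (Suc s) * 2 ^ s) powr ?p * real m ^ Suc s" .
  then have "1 / real m ^ Suc s \<le> (real (Suc s) * 2 ^ s) powr ?p / real k powr ?p"
    using k m(1) by (simp add: field_simps)
  then have "4 ^ s * ?n ^ 2 * (1 / real m ^ Suc s)
      \<le> 4 ^ s * ?n ^ 2 * ((real (Suc s) * 2 ^ s) powr ?p / real k powr ?p)"
    by (intro mult_left_mono) auto
  with h show ?thesis by (simp add: algebra_simps)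
qed

theorem theorem1p1:
  fixes r :: nat
  assumes "r \<ge> 3"
  shows "\<exists>c :: real. \<forall>n k :: nat. n > 0 \<longrightarrow> k > 0 \<longrightarrow>
    real (h_max n k (complete_graph r)) \<le>
      c * (real n ^ 2 / real k powr ((real r - 1) / (real r - 2)))"
proof -
  define s where "s = r - 2"
  have s: "s > 0" "r = s + 2" using assms by (auto simp: s_def)
  have p: "(real r - 1) / (real r - 2) = real (Suc s) / real s"
    by (simp add: s(2))
  show ?thesis
    unfolding p
  \<comment> \<open>The constant stays schematic here and is fixed by the final \<open>show\<close>;
    it depends on \<open>s\<close> only.\<close>
  proof (intro exI allI impI)
    fix n k :: nat assume k: "k > 0"
    \<comment> \<open>The maximum is attained, so the bound for individual graphs carries
      over.\<close>
    have "h_max n k (complete_graph r) \<in> {h_graph G k | G :: nat graph.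
        finite_simple_graph G \<and> card (verts G) = n \<and> subgraph_free (complete_graph r) G}"
      unfolding h_max_def using assms
      by (intro Max_in finite_h_values[OF k] h_values_nonempty) simp
    then obtain G :: "nat graph" where G: "h_max n k (complete_graph r) = h_graph G k"
      "finite_simple_graph G" "card (verts G) = n" "subgraph_free (complete_graph r) G"
      by blast
    show "real (h_max n k (complete_graph r)) \<le>
        4 ^ s * (real (Suc s) * 2 ^ s) powr (real (Suc s) / real s) *
        (real n ^ 2 / real k powr (real (Suc s) / real s))"
      using h_graph_complete_free_le[OF G(2) _ s(1) k] G s(2) by simp
  qed
qed

end
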